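(* The packing density $p(1324)$ of the permutation $1324$ satisfies $$0.244054321 < p(1324) < 0.244054549.$$
   Context: A permutation of length $n$ is an ordered tuple $P=P[1]P[2]\cdots P[n]$ using each integer of $\{1,\ldots,n\}$ exactly once; tuples are written as strings, e.g. $1324$ stands for $(1,3,2,4)$. For permutations $S$ of length $m$ and $P$ of length $n\ge m$, $\#(S,P)$ denotes the number of $m$-subsets $\{k_1<\cdots<k_m\}$ of $\{1,\ldots,n\}$ such that $P[k_1]\cdots P[k_m]$ is order-isomorphic to $S$ (i.e. for all $i,j$, $S[i]<S[j]$ if and only if $P[k_i]<P[k_j]$). The density of $S$ in $P$ is $p(S,P)=\#(S,P)/\binom{n}{m}$. Let $p(S,n)$ be the maximum of $p(S,P)$ over all permutations $P$ of length $n$. The packing density of $S$ is $p(S)=\lim_{n\to\infty}p(S,n)$ (the limit exists because the sequence is non-increasing for $n \ge m$ and bounded below by $0$). *)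

theory Defs
  imports Complex_Main "HOL-Combinatorics.Multiset_Permutations"
begin

definition order_isomorphic :: "nat list \<Rightarrow> nat list \<Rightarrow> bool" where
  "order_isomorphic S T \<longleftrightarrow> length S = length T \<and>
     (\<forall>i<length S. \<forall>j<length S. S ! i < S ! j \<longleftrightarrow> T ! i < T ! j)"

(* A permutation of length n is an element of permutations_of_set {1..n}, i.e. a list;
   positions are therefore counted from 0.  The list  nths P K  consists of the entries
   of P at the positions in K, in increasing order of position. *)

definition occurrences :: "nat list \<Rightarrow> nat list \<Rightarrow> nat set set" where
  "occurrences S P =
     {K. K \<subseteq> {..<length P} \<and> card K = length S \<and> order_isomorphic S (nths P K)}"

definition pattern_density :: "nat list \<Rightarrow> nat list \<Rightarrow> real" where
  "pattern_density S P = real (card (occurrences S P)) / real (length P choose length S)"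

(* For n < length S the binomial coefficient is 0 and this is 0; such n do not
   affect the limit. *)

definition max_density :: "nat list \<Rightarrow> nat \<Rightarrow> real" where
  "max_density S n = Max (pattern_density S ` permutations_of_set {1..n})"

definition packing_density :: "nat list \<Rightarrow> real" where
  "packing_density S = lim (max_density S)"

(* The rest shows that the limit in packing_density exists. *)

lemma finite_occurrences: "finite (occurrences S P)"
  by (rule finite_subset[of _ "Pow {..<length P}"]) (auto simp: occurrences_def)

lemma length_permutation: "P \<in> permutations_of_set {1..n::nat} \<Longrightarrow> length P = n"
  using length_finite_permutations_of_set[of P "{1..n}"] by simp

lemma permutations_nonempty: "permutations_of_set {1..n::nat} \<noteq> {}"
  by simp

lemma pattern_density_le_max:
  "P \<in> permutations_of_set {1..n} \<Longrightarrow> pattern_density S P \<le> max_density S n"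
  unfolding max_density_def by (intro Max_ge) auto

lemma max_density_nonneg: "0 \<le> max_density S n"
proof -
  obtain P where "P \<in> permutations_of_set {1..n}"
    using permutations_nonempty by blast
  then have "pattern_density S P \<le> max_density S n"
    by (rule pattern_density_le_max)
  moreover have "0 \<le> pattern_density S P"
    by (simp add: pattern_density_def)
  ultimately show ?thesis by linarith
qed

definition skip :: "nat \<Rightarrow> nat \<Rightarrow> nat" where
  "skip i k = (if k < i then k else Suc k)"

lemma inj_skip: "inj (skip i)"
  by (auto simp: inj_on_def skip_def split: if_splits)

lemma skip_mem: "k < i \<Longrightarrow> k \<in> skip i ` K \<longleftrightarrow> k \<in> K"
  "i \<notin> skip i ` K" "Suc (j + i) \<in> skip i ` K \<longleftrightarrow> j + i \<in> K"
  by (auto simp: skip_def image_iff split: if_splits intro: bexI[of _ k] bexI[of _ "j + i"])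

lemma nths_cong_lt:
  "(\<And>k. k < length A \<Longrightarrow> k \<in> K \<longleftrightarrow> k \<in> L) \<Longrightarrow> nths A K = nths A L"
proof -
  assume *: "\<And>k. k < length A \<Longrightarrow> k \<in> K \<longleftrightarrow> k \<in> L"
  have "filter (\<lambda>p. snd p \<in> K) (zip A [0..<length A]) = filter (\<lambda>p. snd p \<in> L) (zip A [0..<length A])"
    by (intro filter_cong) (auto dest!: set_zip_rightD simp: *)
  then show ?thesis by (simp add: nths_def)
qed

lemma nths_skip:
  "nths (A @ x # B) (skip (length A) ` K) = nths (A @ B) K"
  by (simp add: nths_append nths_Cons skip_mem nths_cong_lt[of A "skip (length A) ` K" K])

lemma order_isomorphic_map:
  assumes "strict_mono_on (set T) f"
  shows "order_isomorphic S (map f T) \<longleftrightarrow> order_isomorphic S T"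
proof -
  have "f (T ! i) < f (T ! j) \<longleftrightarrow> T ! i < T ! j" if "i < length T" "j < length T" for i j
    using assms that by (simp add: strict_mono_on_less)
  then show ?thesis
    unfolding order_isomorphic_def by auto
qed

lemma deleted_permutation:
  assumes P: "P \<in> permutations_of_set {1..Suc n}" and i: "i < Suc n"
  obtains Q where "Q \<in> permutations_of_set {1..n}"
    "card {K \<in> occurrences S P. i \<notin> K} = card (occurrences S Q)"
proof -
  define A where "A = take i P"
  define x where "x = P ! i"
  define B where "B = drop (Suc i) P"
  have len: "length P = Suc n" using length_permutation[OF P] .
  have P_eq: "P = A @ x # B" and lA: "length A = i"
    using len i by (auto simp: A_def x_def B_def id_take_nth_drop)
  have PS: "set P = {1..Suc n}" "distinct P"
    using P by (auto simp: permutations_of_set_def)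
  have x: "1 \<le> x" "x \<le> Suc n"
    using PS(1) unfolding P_eq by (metis atLeastAtMost_iff in_set_conv_decomp)+
  have AB: "set (A @ B) = {1..Suc n} - {x}" "distinct (A @ B)"
    using PS unfolding P_eq by auto
  define f where "f y = (if x < y then y - 1 else y)" for y
  have f: "strict_mono_on (set (A @ B)) f"
    unfolding AB strict_mono_on_def f_def by auto
  define Q where "Q = map f (A @ B)"
  have "f ` ({1..Suc n} - {x}) = {1..n}"
  proof (intro equalityI subsetI)
    fix y assume "y \<in> {1..n}"
    then show "y \<in> f ` ({1..Suc n} - {x})"
      by (intro image_eqI[of _ _ "if y < x then y else Suc y"]) (auto simp: f_def)
  qed (use x in \<open>auto simp: f_def\<close>)
  then have Q: "Q \<in> permutations_of_set {1..n}"
    using AB strict_mono_on_imp_inj_on[OF f] unfolding Q_def permutations_of_set_def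
    by (metis (mono_tags, lifting) distinct_map list.set_map mem_Collect_eq)
  have lQ: "length Q = n" using length_permutation[OF Q] .
  have iso: "order_isomorphic S (nths Q K) \<longleftrightarrow> order_isomorphic S (nths P (skip i ` K))" for K
  proof -
    have "strict_mono_on (set (nths (A @ B) K)) f"
      using f set_nths_subset[of "A @ B" K] by (auto simp: strict_mono_on_def)
    then show ?thesis
      unfolding Q_def P_eq nths_map lA[symmetric] nths_skip by (rule order_isomorphic_map)
  qed
  have "{K \<in> occurrences S P. i \<notin> K} = image (skip i) ` occurrences S Q"
  proof (intro equalityI subsetI)
    fix K assume K: "K \<in> {K \<in> occurrences S P. i \<notin> K}"
    define L where "L = {k. skip i k \<in> K}"
    have "k \<in> range (skip i)" if "k \<noteq> i" for k
      using that by (cases "k < i")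
        (auto simp: skip_def image_iff intro: exI[of _ k] exI[of _ "k - 1"])
    then have L: "K = skip i ` L"
      using K unfolding L_def image_iff by (auto simp: image_iff) (metis rangeE)
    have "L \<subseteq> {..<n}"
      using K i len by (auto simp: L_def occurrences_def skip_def split: if_splits)
    then have "L \<in> occurrences S Q"
      using K iso[of L] L lQ card_image[OF inj_on_subset[OF inj_skip], of L i]
      by (auto simp: occurrences_def)
    then show "K \<in> image (skip i) ` occurrences S Q" using L by blast
  next
    fix K assume "K \<in> image (skip i) ` occurrences S Q"
    then obtain L where L: "K = skip i ` L" "L \<in> occurrences S Q" by blast
    then show "K \<in> {K \<in> occurrences S P. i \<notin> K}"
      using iso[of L] len lQ card_image[OF inj_on_subset[OF inj_skip], of L i]
      by (auto simp: occurrences_def skip_mem) (auto simp: skip_def)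
  qed
  moreover have "inj_on (image (skip i)) (occurrences S Q)"
    using inj_skip by (auto simp: inj_on_def inj_image_eq_iff)
  ultimately show ?thesis
    using that[OF Q] by (simp add: card_image)
qed

lemma max_density_Suc_le:
  assumes mn: "length S \<le> n"
  shows "max_density S (Suc n) \<le> max_density S n"
proof -
  let ?m = "length S"
  have pos: "real (n choose ?m) > 0" "real (Suc n choose ?m) > 0"
    using mn by simp_all
  have bin: "real (Suc n - ?m) * real (Suc n choose ?m) = real (Suc n) * real (n choose ?m)"
    using binomial_absorb_comp[of "Suc n" ?m] by (metis diff_Suc_1 of_nat_mult)
  have "pattern_density S P \<le> max_density S n" if P: "P \<in> permutations_of_set {1..Suc n}" for P
  proof -
    have len: "length P = Suc n" using length_permutation[OF P] .
    have le: "real (card {K \<in> occurrences S P. i \<notin> K}) \<le> max_density S n * real (n choose ?m)"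
      if i: "i < Suc n" for i
    proof -
      obtain Q where Q: "Q \<in> permutations_of_set {1..n}"
        "card {K \<in> occurrences S P. i \<notin> K} = card (occurrences S Q)"
        using deleted_permutation[OF P i] by blast
      show ?thesis
        using pattern_density_le_max[OF Q(1), of S] pos length_permutation[OF Q(1)] Q(2)
        by (simp add: pattern_density_def field_simps)
    qed
    have "(\<Sum>i<Suc n. card {K \<in> occurrences S P. i \<notin> K})
        = (\<Sum>K\<in>occurrences S P. card {i \<in> {..<Suc n}. i \<notin> K})"
      using sum.swap_restrict[of "{..<Suc n}" "occurrences S P" "\<lambda>_ _. 1::nat" "\<lambda>i K. i \<notin> K"]
        finite_occurrences by simp
    also have "\<dots> = (\<Sum>K\<in>occurrences S P. Suc n - ?m)"
    proof (rule sum.cong)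
      fix K assume "K \<in> occurrences S P"
      then have K: "K \<subseteq> {..<Suc n}" "card K = ?m" using len by (auto simp: occurrences_def)
      have "{i \<in> {..<Suc n}. i \<notin> K} = {..<Suc n} - K" by auto
      then show "card {i \<in> {..<Suc n}. i \<notin> K} = Suc n - ?m"
        using K card_Diff_subset[of K "{..<Suc n}"] finite_subset[OF K(1)] by simp
    qed simp
    finally have "real (Suc n - ?m) * real (card (occurrences S P))
        = (\<Sum>i<Suc n. real (card {K \<in> occurrences S P. i \<notin> K}))"
      by (simp only: of_nat_sum[symmetric] of_nat_mult[symmetric] sum_constant mult.commute of_nat_id)
    also have "\<dots> \<le> (\<Sum>i<Suc n. max_density S n * real (n choose ?m))"
      by (intro sum_mono le) simp
    also have "\<dots> = max_density S n * (real (Suc n) * real (n choose ?m))"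
      by simp
    also have "\<dots> = real (Suc n - ?m) * (max_density S n * real (Suc n choose ?m))"
      by (simp only: bin[symmetric] mult_ac)
    finally have "real (card (occurrences S P)) \<le> max_density S n * real (Suc n choose ?m)"
      using pos len by (simp add: pattern_density_def pos_divide_le_eq)
    then show ?thesis
      using pos len by (simp only: pattern_density_def pos_divide_le_eq)
  qed
  then show ?thesis
    unfolding max_density_def[of S "Suc n"] by (subst Max_le_iff) auto
qed

lemma convergent_max_density: "convergent (max_density S)"
proof -
  let ?X = "\<lambda>n. max_density S (n + length S)"
  have dec: "decseq ?X"
    by (intro decseq_SucI) (simp add: max_density_Suc_le)
  have "convergent ?X"
    using decseq_convergent[OF dec, of 0] max_density_nonneg by (metis convergentI)
  then show ?thesis
    using convergent_ignore_initial_segment[of "max_density S" "length S"] by simp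
qed

end

theory Submission
  imports Defs
begin

text \<open>
  The points of a permutation are partially ordered by: \<open>p\<close> is below \<open>q\<close> if \<open>q\<close> lies to the
  right of and above \<open>p\<close>. An occurrence of 1324 is a diamond of this order, two incomparable elements
  \<open>b, c\<close> with a common lower bound \<open>a\<close> and a common upper bound \<open>d\<close>.

  The upper bound rests on a relaxation in the style of Motzkin and Straus. Distribute a total weight of 1
  over the points, and let a diamond count with the product of its four weights; diamonds with \<open>b = c\<close>
  are admitted. When weight is moved between two incomparable points, the total is a convex function of the
  amount (\<open>diamond_weight_shift\<close>), so all the weight of one of the two can be moved to the other one
  without loss. Repeating this makes the support a chain (\<open>diamond_weight_le_chain\<close>).

  On a chain the partial sums of the weights are the break points of a path from 0 to 1. Up to the factor 12,
  which relates the total to the density, the total is the sum over all steps from \<open>x\<close> to \<open>y\<close> of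
  \<open>(y - x)\<^sup>2 x (1 - y)\<close>. Hence every permutation has density at most the largest weight of a path
  from 0 to 1, up to a factor that tends to 1. Conversely, the layered permutations whose layers are
  proportional to the steps of a given path attain its weight in the limit
  (\<open>packing_density_ge_layered\<close>). The packing density of 1324 is thus the value of a longest path problem
  on the unit interval.

  A lower bound for this value is given by any single path; a path with 13 steps suffices. An upper bound is
  given by a potential \<open>V\<close> for which \<open>V y - V x\<close> is at least the weight of the step from \<open>x\<close>
  to \<open>y\<close>; the value is then at most \<open>V 1 - V 0\<close>. The best paths have infinitely many break
  points, which accumulate at both ends of the interval and approach a geometric progression there. This
  scaling makes it possible to use a potential that is a polynomial on each half of the interval. The
  resulting bound 0.244054548 exceeds the true value 0.2440545239... by less than 0.00000003. What has to be checked are polynomial inequalities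
  in two variables, for a step within one half (\<open>prefix_gain_step\<close>) and for the step across the middle
  (\<open>bridge\<close>).
\<close>

section \<open>Weighted diamonds in finite orders\<close>

locale finite_strict_order =
  fixes A :: "'a set" and lt :: "'a \<Rightarrow> 'a \<Rightarrow> bool" (infix \<open>\<prec>\<close> 50)
  assumes finite_A: "finite A"
    and irrefl: "\<not> x \<prec> x"
    and trans: "x \<prec> y \<Longrightarrow> y \<prec> z \<Longrightarrow> x \<prec> z"
begin

text \<open>
  The middle elements \<open>b\<close> and \<open>c\<close> may coincide. A point of positive weight stands for a whole
  antichain, and the degenerate diamonds with \<open>b = c\<close> account for the pairs inside that antichain.
\<close>

definition diamonds :: "('a \<times> 'a \<times> 'a \<times> 'a) set" where
  "diamonds = {(a, b, c, d). {a, b, c, d} \<subseteq> A \<and> a \<prec> b \<and> a \<prec> c \<and> b \<prec> d \<and> c \<prec> d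
     \<and> \<not> b \<prec> c \<and> \<not> c \<prec> b}"

definition diamond_weight :: "('a \<Rightarrow> real) \<Rightarrow> real" where
  "diamond_weight w = (\<Sum>(a, b, c, d)\<in>diamonds. w a * w b * w c * w d)"

definition chain :: "'a set \<Rightarrow> bool" where
  "chain C \<longleftrightarrow> (\<forall>x\<in>C. \<forall>y\<in>C. x = y \<or> x \<prec> y \<or> y \<prec> x)"

lemma finite_diamonds: "finite diamonds"
  by (rule finite_subset[of _ "A \<times> A \<times> A \<times> A"]) (auto simp: diamonds_def finite_A)

text \<open>
  The weight of at most one element of a chain is changed by the shift, since \<open>x\<close> and \<open>y\<close> are
  incomparable. So a product over a diamond has degree at
  most 2 in \<open>t\<close>, and degree 2 only through the middle pair \<open>b, c\<close>. For fixed ends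
  \<open>a\<close> and \<open>d\<close> the quadratic terms add up to a square, whence convexity in \<open>t\<close>.
\<close>

lemma diamond_weight_shift:
  assumes xy: "x \<in> A" "y \<in> A" "x \<noteq> y" "\<not> x \<prec> y" "\<not> y \<prec> x" and w: "\<And>i. 0 \<le> w i"
  defines "v \<equiv> \<lambda>i. of_bool (i = x) - of_bool (i = y)"
  shows "\<exists>\<alpha> \<beta>. 0 \<le> \<alpha> \<and>
    (\<forall>t. diamond_weight (\<lambda>i. w i + t * v i) = diamond_weight w + t * \<beta> + t\<^sup>2 * \<alpha>)"
proof -
  define \<beta> where "\<beta> = (\<Sum>(a, b, c, d)\<in>diamonds. v a * w b * w c * w d + w a * v b * w c * w d
      + w a * w b * v c * w d + w a * w b * w c * v d)"
  define \<alpha> where "\<alpha> = (\<Sum>(a, b, c, d)\<in>diamonds. w a * v b * v c * w d)"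
  have quadratic: "diamond_weight (\<lambda>i. w i + t * v i) = diamond_weight w + t * \<beta> + t\<^sup>2 * \<alpha>" for t
    unfolding diamond_weight_def \<alpha>_def \<beta>_def sum_distrib_left sum.distrib[symmetric]
  proof (rule sum.cong, simp, clarify)
    fix a b c d assume "(a, b, c, d) \<in> diamonds"
    then have *: "a \<prec> b" "a \<prec> c" "b \<prec> d" "c \<prec> d" "a \<prec> d"
      using trans by (auto simp: diamonds_def)
    have "v i * v j = 0" if "i \<prec> j" for i j
      using that xy irrefl by (auto simp: v_def)
    then have "v a * v b = 0" "v a * v c = 0" "v a * v d = 0" "v b * v d = 0" "v c * v d = 0"
      using * by blast+
    then show "(w a + t * v a) * (w b + t * v b) * (w c + t * v c) * (w d + t * v d)
        = w a * w b * w c * w d + t * (v a * w b * w c * w d + w a * v b * w c * w d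
          + w a * w b * v c * w d + w a * w b * w c * v d) + t\<^sup>2 * (w a * v b * v c * w d)"
      by algebra
  qed
  define f where "f a d b = v b * of_bool (a \<prec> b \<and> b \<prec> d)" for a d b
  \<comment> \<open>The products survive only for \<open>b, c \<in> {x, y}\<close>, and no two elements of \<open>{x, y}\<close>
  are comparable: the conditions on \<open>b\<close> and on \<open>c\<close> decouple.\<close>
  have "\<alpha> = (\<Sum>(a, b, c, d)\<in>A \<times> {x, y} \<times> {x, y} \<times> A. w a * w d * f a d b * f a d c)"
    unfolding \<alpha>_def
  proof (rule sum.mono_neutral_cong)
    show "finite diamonds" "finite (A \<times> {x, y} \<times> {x, y} \<times> A)"
      by (auto simp: finite_diamonds finite_A)
  qed (use xy irrefl in \<open>auto simp: diamonds_def v_def f_def split: if_splits\<close>)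
  also have "\<dots> = (\<Sum>a\<in>A. \<Sum>d\<in>A. w a * w d * (f a d x + f a d y)\<^sup>2)"
    using xy by (simp add: sum.cartesian_product[symmetric] sum.distrib[symmetric] power2_eq_square algebra_simps)
  also have "0 \<le> \<dots>"
    using w by (intro sum_nonneg mult_nonneg_nonneg) auto
  finally have "0 \<le> \<alpha>" .
  with quadratic show ?thesis by blast
qed

text \<open>
  A convex function on an interval does not decrease towards one of its ends, and at either end one of
  \<open>x\<close>, \<open>y\<close> has lost all its weight.
\<close>

lemma diamond_weight_concentrate:
  assumes xy: "x \<in> A" "y \<in> A" "x \<noteq> y" "\<not> x \<prec> y" "\<not> y \<prec> x" and w: "\<And>i. 0 \<le> w i"
    and pos: "w x \<noteq> 0" "w y \<noteq> 0"
  shows "\<exists>w'. (\<forall>i. 0 \<le> w' i) \<and> sum w' A = sum w A \<and> diamond_weight w \<le> diamond_weight w'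
    \<and> {i \<in> A. w' i \<noteq> 0} \<subset> {i \<in> A. w i \<noteq> 0}"
proof -
  define v :: "'a \<Rightarrow> real" where "v = (\<lambda>i. of_bool (i = x) - of_bool (i = y))"
  obtain \<alpha> \<beta> where \<alpha>: "0 \<le> \<alpha>"
    and shift: "\<And>t. diamond_weight (\<lambda>i. w i + t * v i) = diamond_weight w + t * \<beta> + t\<^sup>2 * \<alpha>"
    using diamond_weight_shift[OF xy, of w, OF w] unfolding v_def by blast
  define t where "t = (if 0 \<le> \<beta> then w y else - w x)"
  have "0 \<le> t * \<beta>" using w[of x] w[of y] by (auto simp: t_def mult_nonneg_nonpos)
  show ?thesis
  proof (intro exI[of _ "\<lambda>i. w i + t * v i"] conjI allI)
    show "0 \<le> w i + t * v i" for i
      using w[of i] w[of x] w[of y] by (auto simp: t_def v_def)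
    have "(\<Sum>i\<in>A. v i) = 0"
      using xy finite_A by (simp add: v_def sum_subtractf of_bool_def)
    then show "(\<Sum>i\<in>A. w i + t * v i) = sum w A"
      by (simp add: sum.distrib flip: sum_distrib_left)
    show "diamond_weight w \<le> diamond_weight (\<lambda>i. w i + t * v i)"
      unfolding shift using \<open>0 \<le> t * \<beta>\<close> \<alpha> by simp
    show "{i \<in> A. w i + t * v i \<noteq> 0} \<subset> {i \<in> A. w i \<noteq> 0}"
      using xy pos by (auto simp: t_def v_def split: if_splits)
  qed
qed

lemma diamond_weight_le_chain:
  assumes "\<And>i. 0 \<le> w i"
  shows "\<exists>w'. (\<forall>i. 0 \<le> w' i) \<and> sum w' A = sum w A \<and> diamond_weight w \<le> diamond_weight w'
    \<and> chain {i \<in> A. w' i \<noteq> 0}"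
  using assms
proof (induction "card {i \<in> A. w i \<noteq> 0}" arbitrary: w rule: less_induct)
  case less
  show ?case
  proof (cases "chain {i \<in> A. w i \<noteq> 0}")
    case True
    then show ?thesis using less.prems by blast
  next
    case False
    then obtain x y where xy: "x \<in> A" "y \<in> A" "x \<noteq> y" "\<not> x \<prec> y" "\<not> y \<prec> x" "w x \<noteq> 0" "w y \<noteq> 0"
      unfolding chain_def by auto
    obtain w' where w': "\<forall>i. 0 \<le> w' i" "sum w' A = sum w A" "diamond_weight w \<le> diamond_weight w'"
      "{i \<in> A. w' i \<noteq> 0} \<subset> {i \<in> A. w i \<noteq> 0}"
      using diamond_weight_concentrate[OF xy(1-5), of w, OF less.prems xy(6,7)] by blast
    have "card {i \<in> A. w' i \<noteq> 0} < card {i \<in> A. w i \<noteq> 0}"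
      using w'(4) finite_A by (intro psubset_card_mono) auto
    from less.hyps[OF this] w'(1) obtain w'' where "\<forall>i. 0 \<le> w'' i" "sum w'' A = sum w' A"
      "diamond_weight w' \<le> diamond_weight w''" "chain {i \<in> A. w'' i \<noteq> 0}"
      by blast
    then show ?thesis using w'(2,3) by (intro exI[of _ w'']) auto
  qed
qed

text \<open>
  On a chain only the degenerate diamonds \<open>b = c\<close> are left.
\<close>

lemma diamond_weight_chain:
  assumes "chain {i \<in> A. w i \<noteq> 0}"
  defines "C \<equiv> {i \<in> A. w i \<noteq> 0}"
  shows "diamond_weight w = (\<Sum>b\<in>C. (w b)\<^sup>2 * sum w {a \<in> C. a \<prec> b} * sum w {d \<in> C. b \<prec> d})"
proof -
  have fin: "finite C" unfolding C_def using finite_A by simp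
  define T where "T = (SIGMA b:C. {a \<in> C. a \<prec> b} \<times> {d \<in> C. b \<prec> d})"
  define f where "f = (\<lambda>(b, a, d). (a :: 'a, b :: 'a, b, d :: 'a))"
  have "f ` T \<subseteq> diamonds"
    using irrefl by (auto simp: f_def T_def C_def diamonds_def)
  moreover have in_image: "(a, b, c, d) \<in> f ` T"
    if "(a, b, c, d) \<in> diamonds" "w a * w b * w c * w d \<noteq> 0" for a b c d
  proof -
    have *: "a \<in> C" "b \<in> C" "c \<in> C" "d \<in> C" "a \<prec> b" "b \<prec> d" "\<not> b \<prec> c" "\<not> c \<prec> b"
      using that by (auto simp: C_def diamonds_def)
    moreover have "b = c" using * assms(1) unfolding chain_def C_def by blast
    ultimately show ?thesis
      by (intro image_eqI[of _ _ "(b, a, d)"]) (auto simp: f_def T_def)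
  qed
  ultimately have "diamond_weight w = (\<Sum>(a, b, c, d)\<in>f ` T. w a * w b * w c * w d)"
    unfolding diamond_weight_def
  proof (intro sum.mono_neutral_right finite_diamonds ballI)
    fix q assume q: "q \<in> diamonds - f ` T"
    obtain a b c d where "q = (a, b, c, d)" by (cases q)
    then show "(case q of (a, b, c, d) \<Rightarrow> w a * w b * w c * w d) = 0"
      using in_image[of a b c d] q by auto
  qed
  also have "\<dots> = (\<Sum>(b, a, d)\<in>T. w a * w b * w b * w d)"
    by (subst sum.reindex) (auto simp: f_def inj_on_def intro!: sum.cong)
  also have "\<dots> = (\<Sum>b\<in>C. \<Sum>(a, d)\<in>{a \<in> C. a \<prec> b} \<times> {d \<in> C. b \<prec> d}. w a * w b * w b * w d)"
    unfolding T_def using fin by (subst sum.Sigma) (auto intro!: sum.cong)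
  also have "\<dots> = (\<Sum>b\<in>C. (w b)\<^sup>2 * sum w {a \<in> C. a \<prec> b} * sum w {d \<in> C. b \<prec> d})"
    by (intro sum.cong refl)
      (simp add: sum.cartesian_product[symmetric] mult.assoc sum_product sum_distrib_left power2_eq_square mult_ac)
  finally show ?thesis .
qed

text \<open>
  Along the chain the partial sums of the weights are the break points of a path from 0 to the total
  weight. The element \<open>b\<close> makes the step from \<open>x\<close>, the weight below it, to
  \<open>y = x + w b\<close>, and its summand is the weight \<open>12 (y - x)\<^sup>2 x (1 - y)\<close> of that step.
  The bound telescopes; the induction removes the top element.
\<close>

lemma chain_potential_bound:
  fixes V :: "real \<Rightarrow> real" and w :: "'a \<Rightarrow> real"
  assumes V: "\<And>x y. 0 \<le> x \<Longrightarrow> x \<le> y \<Longrightarrow> y \<le> 1 \<Longrightarrow> 12 * (y - x)\<^sup>2 * x * (1 - y) \<le> V y - V x"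
    and "finite C" "chain C" and w: "\<And>i. 0 \<le> w i" and "sum w C \<le> 1"
  shows "(\<Sum>b\<in>C. 12 * (w b)\<^sup>2 * sum w {a \<in> C. a \<prec> b} * (1 - sum w {a \<in> C. a \<prec> b} - w b))
    \<le> V (sum w C) - V 0"
  using assms(2,3,5)
proof (induction "card C" arbitrary: C)
  case 0
  then show ?case by simp
next
  case (Suc n)
  have "C \<noteq> {}" using Suc.hyps(2) by auto
  moreover have "asymp_on C (\<prec>)"
    by (rule asymp_onI) (metis irrefl trans)
  moreover have "transp_on C (\<prec>)"
    by (rule transp_onI) (rule trans)
  ultimately obtain m where "m \<in> C" "\<forall>x\<in>C. \<not> m \<prec> x"
    using Finite_Set.bex_max_element[of C "(\<prec>)"] Suc.prems(1) irrefl by metis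
  then have m: "m \<in> C" "\<forall>x\<in>C - {m}. x \<prec> m"
    using Suc.prems(2) unfolding chain_def by blast+
  define D where "D = C - {m}"
  have D: "finite D" "chain D" "card D = n" "C = insert m D" "m \<notin> D"
    using Suc.prems Suc.hyps(2) m unfolding D_def chain_def by auto
  have below_m: "{a \<in> C. a \<prec> m} = D"
    using m irrefl D_def by auto
  have below: "{a \<in> C. a \<prec> b} = {a \<in> D. a \<prec> b}" if "b \<in> D" for b
    using that m irrefl trans unfolding D_def by blast
  have sumC: "sum w C = w m + sum w D" using D by simp
  have "sum w D \<ge> 0" using w by (simp add: sum_nonneg)
  have "(\<Sum>b\<in>C. 12 * (w b)\<^sup>2 * sum w {a \<in> C. a \<prec> b} * (1 - sum w {a \<in> C. a \<prec> b} - w b))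
      = 12 * (w m)\<^sup>2 * sum w D * (1 - sum w D - w m)
        + (\<Sum>b\<in>D. 12 * (w b)\<^sup>2 * sum w {a \<in> D. a \<prec> b} * (1 - sum w {a \<in> D. a \<prec> b} - w b))"
    using D below below_m by (subst (1) D(4)) simp
  also have "\<dots> \<le> (V (sum w C) - V (sum w D)) + (V (sum w D) - V 0)"
  proof (rule add_mono)
    show "12 * (w m)\<^sup>2 * sum w D * (1 - sum w D - w m) \<le> V (sum w C) - V (sum w D)"
      using V[of "sum w D" "sum w C"] w[of m] \<open>sum w D \<ge> 0\<close> Suc.prems(3) sumC by (simp add: algebra_simps)
    show "(\<Sum>b\<in>D. 12 * (w b)\<^sup>2 * sum w {a \<in> D. a \<prec> b} * (1 - sum w {a \<in> D. a \<prec> b} - w b)) \<le> V (sum w D) - V 0"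
      using Suc.hyps(1)[of D] D Suc.prems(3) sumC w[of m] by simp
  qed
  finally show ?case by simp
qed

lemma diamond_weight_le_potential:
  fixes V :: "real \<Rightarrow> real"
  assumes V: "\<And>x y. 0 \<le> x \<Longrightarrow> x \<le> y \<Longrightarrow> y \<le> 1 \<Longrightarrow> 12 * (y - x)\<^sup>2 * x * (1 - y) \<le> V y - V x"
    and w: "\<And>i. 0 \<le> w i" "sum w A = 1"
  shows "12 * diamond_weight w \<le> V 1 - V 0"
proof -
  obtain w' where w': "\<forall>i. 0 \<le> w' i" "sum w' A = sum w A" "diamond_weight w \<le> diamond_weight w'"
    "chain {i \<in> A. w' i \<noteq> 0}"
    using diamond_weight_le_chain[of w, OF w(1)] by blast
  define C where "C = {i \<in> A. w' i \<noteq> 0}"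
  have fin: "finite C" and C: "chain C" using finite_A w'(4) by (auto simp: C_def)
  have total: "sum w' C = 1"
    using w'(2) w(2) finite_A unfolding C_def by (subst sum.mono_neutral_left[of A]) auto
  have above: "sum w' {d \<in> C. b \<prec> d} = 1 - sum w' {a \<in> C. a \<prec> b} - w' b" if "b \<in> C" for b
  proof -
    have "C = {a \<in> C. a \<prec> b} \<union> {b} \<union> {d \<in> C. b \<prec> d}"
      using that C unfolding chain_def by blast
    then have "sum w' C = sum w' ({a \<in> C. a \<prec> b} \<union> {b} \<union> {d \<in> C. b \<prec> d})" by simp
    also have "\<dots> = sum w' {a \<in> C. a \<prec> b} + w' b + sum w' {d \<in> C. b \<prec> d}"
    proof -
      have "{a \<in> C. a \<prec> b} \<inter> {b} = {}" "({a \<in> C. a \<prec> b} \<union> {b}) \<inter> {d \<in> C. b \<prec> d} = {}"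
        using irrefl trans by blast+
      then show ?thesis using fin by (simp add: sum.union_disjoint)
    qed
    finally show ?thesis using total by simp
  qed
  have "12 * diamond_weight w' = (\<Sum>b\<in>C. 12 * (w' b)\<^sup>2 * sum w' {a \<in> C. a \<prec> b} * sum w' {d \<in> C. b \<prec> d})"
    unfolding diamond_weight_chain[OF w'(4)] C_def by (simp add: sum_distrib_left mult_ac)
  also have "\<dots> = (\<Sum>b\<in>C. 12 * (w' b)\<^sup>2 * sum w' {a \<in> C. a \<prec> b} * (1 - sum w' {a \<in> C. a \<prec> b} - w' b))"
    using above by simp
  also have "\<dots> \<le> V (sum w' C) - V 0"
    using chain_potential_bound[OF V fin C, of w'] w'(1) total by simp
  finally show ?thesis using w'(3) total by simp
qed

end

section \<open>A potential for paths in the unit interval\<close>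

text \<open>
  An upper estimate for the total weight of any path from 0 to \<open>x \<le> 1/2\<close>. Close to 0 the
  weight of a step is \<open>12 (y - x)\<^sup>2 x\<close>, homogeneous of degree 3, so the supremum of these totals
  is \<open>x\<^sup>3\<close> times a slowly varying function with value \<open>sqrt 192 - 12 = 1.8564...\<close> at 0.
  The four coefficients are chosen such that the estimate is almost attained at the steps that end near 0.305
  and near 0.115. These are the outer break points of the best paths, and only the error made there has a
  noticeable effect on the final bound.
\<close>

definition prefix_gain :: "real \<Rightarrow> real" where
  "prefix_gain x = 1.8564204 * x^3 - 1.79793606 * x^4 + 0.006612 * x^5 + 0.031779 * x^8"

text \<open>
  Tangents of the convex function \<open>s ^ Suc n\<close> at \<open>c\<close>.
\<close>

lemma power_ge_tangent:
  fixes c s :: real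
  assumes "0 \<le> c" "0 \<le> s"
  shows "real (Suc n) * c ^ n * s - real n * c ^ Suc n \<le> s ^ Suc n"
proof (induction n)
  case (Suc n)
  have "real (Suc (Suc n)) * c ^ Suc n * s - real (Suc n) * c ^ Suc (Suc n)
      = s * (real (Suc n) * c ^ n * s - real n * c ^ Suc n) - real (Suc n) * c ^ n * (s - c)\<^sup>2"
    by (simp add: algebra_simps power2_eq_square)
  also have "\<dots> \<le> s * s ^ Suc n"
    using mult_left_mono[OF Suc.IH assms(2)] assms by (smt (verit) mult_nonneg_nonneg of_nat_0_le_iff zero_le_power zero_le_power2)
  finally show ?case by simp
qed simp

lemma quadratic_pos:
  fixes a b c s :: real
  assumes "0 < c" "b\<^sup>2 < 4 * a * c"
  shows "0 < a + b * s + c * s\<^sup>2"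
proof -
  have "4 * c * (a + b * s + c * s\<^sup>2) = (2 * c * s + b)\<^sup>2 + (4 * a * c - b\<^sup>2)"
    by algebra
  then have "0 < 4 * c * (a + b * s + c * s\<^sup>2)" using assms by (smt (verit) zero_le_power2)
  then show ?thesis using assms by (simp add: zero_less_mult_iff)
qed

text \<open>
  \<open>A + B s + C s\<^sup>2\<close> is the quadratic minorant used in the next lemma. It almost touches 0
  when \<open>y\<close> is near 0.115 or near 0.31, so the discriminant is almost a multiple of the polynomial
  \<open>W\<close> with double zeros there. Polynomial division by \<open>W\<close> gives the quotient \<open>E\<close> and the
  small remainder \<open>R\<close>; all their coefficients are rounded down, in such a way that what is left over
  has no negative coefficient.
\<close>

lemma step_discriminant_neg:
  fixes y :: real
  assumes y: "0 \<le> y" "y \<le> 1/2"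
  defines "t \<equiv> 0.364 + 0.039 * y"
  defines "A \<equiv> 1.8564204 - 1.79793606 * y * (1 + t\<^sup>2) + 0.006612 * 0.6945 * y^2 + 0.031779 * 0.644 * y^5"
  defines "B \<equiv> 1.8564204 - 12 * (1 - y) - 1.79793606 * y * (1 - 2 * t - t\<^sup>2) + 0.006612 * 2.3828 * y^2 + 0.031779 * 2.545 * y^5"
  defines "C \<equiv> 1.8564204 + 12 * (1 - y) - 1.79793606 * y * (2 + 2 * t)"
  shows "B\<^sup>2 < 4 * A * C"
proof -
  define E where "E = 0.905868 - 0.042376 * y - 3.323457 * y^2 - 0.046771 * y^3 - 0.003533 * y^4 - 0.00557 * y^5 - 0.006542 * y^6"
  define R where "R = 0.00000494 + 0.00034398 * y - 0.00206874 * y^2 + 0.00324553 * y^3"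
  define W where "W = (y - 0.1148)\<^sup>2 * (y - 0.3109)\<^sup>2"
  have "4 * A * C - B\<^sup>2 - W * E - R
      = 0.0000000062464144667968 + 0.0000000040731836205184 * y + 0.0000000063714374131446964224 * y^2
        + 0.0000000075311940639012100096 * y^3 + 0.0000003322441432704983394944 * y^4 + 0.0000004732185511561955346496 * y^5
        + 0.0000000451894015424056024924 * y^6 + 0.0000009090517349011728 * y^7 + 0.0000008863264742765014 * y^8
        + 0.0000001412 * y^9 + 0.000000821097221975 * y^10"
    unfolding A_def B_def C_def E_def R_def W_def t_def
    by algebra
  moreover have "0 \<le> \<dots>" using y by simp
  moreover have "0 \<le> W * E"
  proof -
    have "y^(Suc k) \<le> (1/2)^k * y" for k
      using y by (simp add: mult.commute[of _ y] mult_left_mono power_mono)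
    from this[of 1] this[of 2] this[of 3] this[of 4] this[of 5] have "0 \<le> E"
      using y by (simp add: E_def numeral_eq_Suc power_divide)
    then show ?thesis by (simp add: W_def)
  qed
  moreover have "0 < R"
  proof -
    have "0 < 0.00034398 + (- 0.00206874) * y + 0.00324553 * y\<^sup>2"
      by (rule quadratic_pos) (simp_all add: power_divide)
    then have "0 \<le> y * (0.00034398 + (- 0.00206874) * y + 0.00324553 * y\<^sup>2)"
      using y by simp
    moreover have "R = 0.00000494 + y * (0.00034398 + (- 0.00206874) * y + 0.00324553 * y\<^sup>2)"
      unfolding R_def by algebra
    ultimately show ?thesis by simp
  qed
  ultimately show ?thesis by linarith
qed

text \<open>
  In terms of the ratio \<open>s = x / y\<close> of two break points, this polynomial is what remains of the
  inequality for one step after division by \<open>y\<^sup>3 (1 - s)\<close>. For fixed \<open>y\<close> it is minimal at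
  some \<open>s\<close> between 0.36 and 0.4, and the minimum is less than 0.000001 in the worst cases.
  The powers of \<open>s\<close> are therefore replaced by polynomials of degree at most 2 that are sharp near the
  minimum: by slightly lowered tangents at 3/8 in the two terms of small weight, and in the term with the negative coefficient the
  quadratic that agrees with \<open>s\<^sup>3\<close> at 1 and has a double contact with it at \<open>t\<close>, a linear
  approximation of the minimiser.
\<close>

lemma prefix_step_factor_pos:
  fixes s y :: real
  assumes s: "0 \<le> s" "s \<le> 1" and y: "0 \<le> y" "y \<le> 1/2"
  shows "0 < 1.8564204 * (1 + s + s^2) - 12 * s * (1 - s) * (1 - y)
      - 1.79793606 * y * (1 + s + s^2 + s^3) + 0.006612 * y^2 * (1 + s + s^2 + s^3 + s^4)
      + 0.031779 * y^5 * (1 + s + s^2 + s^3 + s^4 + s^5 + s^6 + s^7)"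
proof -
  define t where "t = 0.364 + 0.039 * y"
  define A where "A = 1.8564204 - 1.79793606 * y * (1 + t\<^sup>2) + 0.006612 * 0.6945 * y^2 + 0.031779 * 0.644 * y^5"
  define B where "B = 1.8564204 - 12 * (1 - y) - 1.79793606 * y * (1 - 2 * t - t\<^sup>2) + 0.006612 * 2.3828 * y^2 + 0.031779 * 2.545 * y^5"
  define C where "C = 1.8564204 + 12 * (1 - y) - 1.79793606 * y * (2 + 2 * t)"
  have "B\<^sup>2 < 4 * A * C"
    unfolding A_def B_def C_def t_def using y by (rule step_discriminant_neg)
  moreover have "0 < C"
  proof -
    have "t \<le> 0.4" using y by (simp add: t_def)
    then have "y * (2 + 2 * t) \<le> 1/2 * 2.8" using y by (intro mult_mono) (auto simp: t_def)
    moreover define z where "z = y * (2 + 2 * t)"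
    ultimately have "z \<le> 1.4" by simp
    moreover have "C = 1.8564204 + 12 * (1 - y) - 1.79793606 * z" by (simp add: C_def z_def)
    ultimately show ?thesis using y by simp
  qed
  ultimately have "0 < A + B * s + C * s\<^sup>2" by (intro quadratic_pos)
  moreover have L4: "0.6945 + 2.3828 * s \<le> 1 + s + s^2 + s^3 + s^4"
    using power_ge_tangent[of "3/8" s 1] power_ge_tangent[of "3/8" s 2] power_ge_tangent[of "3/8" s 3] s
    by (simp add: numeral_eq_Suc)
  moreover have L7: "0.644 + 2.545 * s \<le> 1 + s + s^2 + s^3 + s^4 + s^5 + s^6 + s^7"
    using power_ge_tangent[of "3/8" s 1] power_ge_tangent[of "3/8" s 2] power_ge_tangent[of "3/8" s 3]
     power_ge_tangent[of "3/8" s 4] power_ge_tangent[of "3/8" s 5] power_ge_tangent[of "3/8" s 6] s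
    by (simp add: numeral_eq_Suc)
  moreover have L3: "s^3 \<le> (1 + 2 * t) * s^2 - (2 * t + t\<^sup>2) * s + t\<^sup>2"
  proof -
    have "(1 + 2 * t) * s^2 - (2 * t + t\<^sup>2) * s + t\<^sup>2 - s^3 = (1 - s) * (s - t)\<^sup>2" by algebra
    then show ?thesis using s by (smt (verit) mult_nonneg_nonneg zero_le_power2)
  qed
  define L4 where "L4 = 1 + s + s^2 + s^3 + s^4 - (0.6945 + 2.3828 * s)"
  define L7 where "L7 = 1 + s + s^2 + s^3 + s^4 + s^5 + s^6 + s^7 - (0.644 + 2.545 * s)"
  define L3 where "L3 = (1 + 2 * t) * s^2 - (2 * t + t\<^sup>2) * s + t\<^sup>2 - s^3"
  have "0 \<le> 1.79793606 * y * L3 + 0.006612 * y^2 * L4 + 0.031779 * y^5 * L7"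
    using L3 L4 L7 y by (intro add_nonneg_nonneg mult_nonneg_nonneg) (auto simp: L3_def L4_def L7_def)
  moreover have "1.8564204 * (1 + s + s^2) - 12 * s * (1 - s) * (1 - y)
      - 1.79793606 * y * (1 + s + s^2 + s^3) + 0.006612 * y^2 * (1 + s + s^2 + s^3 + s^4)
      + 0.031779 * y^5 * (1 + s + s^2 + s^3 + s^4 + s^5 + s^6 + s^7)
     = (A + B * s + C * s\<^sup>2) + (1.79793606 * y * L3 + 0.006612 * y^2 * L4 + 0.031779 * y^5 * L7)"
    unfolding A_def B_def C_def L3_def L4_def L7_def by algebra
  ultimately show ?thesis by linarith
qed

lemma prefix_gain_step:
  assumes x: "0 \<le> x" "x \<le> y" and y: "y \<le> 1/2"
  shows "12 * (y - x)\<^sup>2 * x * (1 - y) \<le> prefix_gain y - prefix_gain x"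
proof (cases "y = 0")
  case True
  then show ?thesis using x by (simp add: prefix_gain_def)
next
  case False
  define s where "s = x / y"
  have s: "0 \<le> s" "s \<le> 1" and xs: "x = s * y" using False x by (auto simp: s_def)
  have "prefix_gain y - prefix_gain x - 12 * (y - x)\<^sup>2 * x * (1 - y)
      = y^3 * (1 - s) * (1.8564204 * (1 + s + s^2) - 12 * s * (1 - s) * (1 - y)
      - 1.79793606 * y * (1 + s + s^2 + s^3) + 0.006612 * y^2 * (1 + s + s^2 + s^3 + s^4)
      + 0.031779 * y^5 * (1 + s + s^2 + s^3 + s^4 + s^5 + s^6 + s^7))"
    unfolding xs prefix_gain_def by algebra
  moreover have "0 \<le> \<dots>"
    using s x y prefix_step_factor_pos[OF s, of y] by (intro mult_nonneg_nonneg) auto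
  ultimately show ?thesis by linarith
qed

lemma le_if_scaled_diff_nonneg:
  fixes a b k :: real
  assumes "k * (a - b) = e" "0 < k" "0 \<le> e"
  shows "b \<le> a"
  using assms by (auto simp: zero_le_mult_iff)

text \<open>
  For \<open>x \<le> 1/2\<close> the powers 5 and 8 are absorbed by the cubic term. This is accurate enough for steps
  across 1/2 that are far from optimal.
\<close>

lemma prefix_gain_le_quartic:
  assumes "0 \<le> x" "x \<le> 1/2"
  shows "prefix_gain x \<le> 1.8591 * x^3 - 1.79793606 * x^4"
proof -
  have "x^2 \<le> (1/2)^2" "x^5 \<le> (1/2)^5" using assms by (intro power_mono; simp)+
  then have "0 \<le> x^3 * (0.0026796 - 0.006612 * x^2 - 0.031779 * x^5)"
    using assms by (intro mult_nonneg_nonneg) (auto simp: power_divide)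
  moreover have "1.8591 * x^3 - 1.79793606 * x^4 - prefix_gain x = x^3 * (0.0026796 - 0.006612 * x^2 - 0.031779 * x^5)"
    unfolding prefix_gain_def by algebra
  ultimately show ?thesis by linarith
qed

text \<open>
  The estimate for a symmetric path whose middle step goes from \<open>m\<close> to \<open>1 - m\<close>. As a function of
  \<open>m\<close> it has its maximum 0.2440545445 close to 0.30509442, which explains the double zero that is split
  off. The coefficients of the cofactor \<open>P\<close> are rounded such that those of \<open>R\<close> are positive.
\<close>

lemma symmetric_bridge:
  fixes m :: real
  assumes m: "0 \<le> m" "m \<le> 1/2"
  shows "12 * (1 - 2 * m)\<^sup>2 * m\<^sup>2 + 2 * prefix_gain m \<le> 0.244054548"
proof -
  define P where "P = 2.621913585 + 17.187555069 * m - 44.414950469 * m^2 - 0.020443932 * m^3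
    - 0.017748434 * m^4 - 0.038782383 * m^5 - 0.063558 * m^6"
  define R where "R = 0.000000001121433383712006 + 0.0000000076290034395535884 * m + 0.0000000007034992081789716 * m^2
    + 0.0000000001127907407323248 * m^3 + 0.0000000003213151807963976 * m^4 + 0.0000000008879364189620412 * m^5
    + 0.0000000009207021193112 * m^6 + 0.00000000070728 * m^7"
  have "0.244054548 - 12 * (1 - 2 * m)\<^sup>2 * m\<^sup>2 - 2 * prefix_gain m = (m - 0.30509442)\<^sup>2 * P + R"
    unfolding P_def R_def prefix_gain_def by algebra
  moreover have "0 \<le> P"
  proof -
    have pw: "m^(Suc k) \<le> (1/2)^k * m" for k
      using m by (simp add: mult.commute[of _ m] mult_left_mono power_mono)
    show ?thesis
      using pw[of 1] pw[of 2] pw[of 3] pw[of 4] pw[of 5] m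
      by (simp add: P_def numeral_eq_Suc power_divide)
  qed
  moreover have "0 \<le> R" using m by (simp add: R_def)
  ultimately show ?thesis by (smt (verit) mult_nonneg_nonneg zero_le_power2)
qed

text \<open>
  The identities are Bernstein expansions of the difference of both sides: on the whole interval for the first
  claim, and for the second one, which is tighter at its left end, on the two parts into which 0.37 divides it.
\<close>

lemma quartic_bridge:
  fixes m :: real
  assumes m: "0.33 \<le> m" "m \<le> 1/2"
  shows "12 * (1 - 2 * m)\<^sup>2 * m^2 + 2 * (1.8591 * m^3 - 1.79793606 * m^4) \<le> 0.244" (is "?M \<le> _")
    and "12 * (1 - 2 * m)\<^sup>2 * m^2 + 2 * (1.8591 * m^3 - 1.79793606 * m^4)
      + (11.1546 * m - 21.57523272 * m^2 - 12 * (1 - 2 * m)\<^sup>2) * (1/2 - m)\<^sup>2 \<le> 0.244" (is "?N \<le> _")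
proof -
  define u v where "u = m - 0.33" and "v = 1/2 - m"
  have uv: "0 \<le> u" "0 \<le> v" using m by (auto simp: u_def v_def)
  have "0.17^4 * (0.244 - ?M) = 0.0019571692042252 * v^4 + 0.03568478935288 * u * v^3
      + 0.176963240802 * u^2 * v^2 + 0.1842893998 * u^3 * v + 0.0039670075 * u^4"
    unfolding u_def v_def by algebra
  then show "?M \<le> 0.244" by (rule le_if_scaled_diff_nonneg) (use uv in simp_all)
  show "?N \<le> 0.244"
  proof (cases "m \<le> 0.37")
    case True
    define v' where "v' = 0.37 - m"
    have v': "0 \<le> v'" using True by (simp add: v'_def)
    have "0.04^4 * (0.244 - ?N) = 0.0035676171729364 * v'^4 + 0.0047673922003984 * u * v'^3
        + 0.0079231226670264 * u^2 * v'^2 + 0.0125363182674064 * u^3 * v' + 0.0058774086562324 * u^4"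
      unfolding u_def v'_def by algebra
    then show ?thesis by (rule le_if_scaled_diff_nonneg) (use uv v' in simp_all)
  next
    case False
    define u' where "u' = m - 0.37"
    have u': "0 \<le> u'" using False by (simp add: u'_def)
    have "0.13^4 * (0.244 - ?N) = 0.0058774086562324 * v^4 + 0.05917291278688 * u' * v^3
        + 0.201178458084 * u'^2 * v^2 + 0.1446608422 * u'^3 * v + 0.0039670075 * u'^4"
      unfolding u'_def v_def by algebra
    then show ?thesis by (rule le_if_scaled_diff_nonneg) (use uv u' in simp_all)
  qed
qed

text \<open>
  The step across 1/2 goes from \<open>x\<close> to \<open>1 - z\<close>, and the paths up to \<open>x\<close> and beyond
  \<open>1 - z\<close> are estimated by their gains. With \<open>x = m + d\<close>, \<open>z = m - d\<close> and
  \<open>e = d\<^sup>2\<close> the left-hand side is at most an affine function of \<open>e\<close>. For \<open>m \<le> 0.33\<close> its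
  slope is not positive, so the symmetric case \<open>e = 0\<close> is the worst. For larger \<open>m\<close> there is room to
  spare, a cruder estimate of the gains is good enough, and the affine function is checked at both ends of the
  range of \<open>e\<close>.
\<close>

lemma bridge:
  assumes x: "0 \<le> x" "x \<le> 1/2" and z: "0 \<le> z" "z \<le> 1/2"
  shows "12 * (1 - x - z)\<^sup>2 * x * z + prefix_gain x + prefix_gain z \<le> 0.244054548"
proof -
  define m d e where "m = (x + z) / 2" and "d = (x - z) / 2" and "e = d\<^sup>2"
  have m: "0 \<le> m" "m \<le> 1/2" and xz: "x = m + d" "z = m - d"
    using x z by (auto simp: m_def d_def field_simps)
  have e: "0 \<le> e" "e \<le> m\<^sup>2" "e \<le> (1/2 - m)\<^sup>2"
  proof -
    have "\<bar>d\<bar> \<le> m" "\<bar>d\<bar> \<le> 1/2 - m"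
      using x z by (auto simp: m_def d_def abs_le_iff field_simps)
    then show "0 \<le> e" "e \<le> m\<^sup>2" "e \<le> (1/2 - m)\<^sup>2"
      unfolding e_def using m by (auto simp flip: abs_le_square_iff)
  qed
  show ?thesis
  proof (cases "m \<le> 0.33")
    case True
    \<comment> \<open>The coefficients 30 * 0.006612 and 254 * 0.031779 of the last two summands bound the
    contributions of degree 5 and 8; they come from \<open>e \<le> m\<^sup>2\<close>, with 30 = 20 + 10 and
    254 = 56 + 140 + 56 + 2.\<close>
    define K where "K = 11.1385224 * m - 21.57523272 * m^2 - 12 * (1 - 2 * m)\<^sup>2 + 0.19836 * m^3 + 8.071866 * m^6"
    have expand: "12 * (1 - x - z)\<^sup>2 * x * z + prefix_gain x + prefix_gain z
        = 12 * (1 - 2 * m)\<^sup>2 * m\<^sup>2 + 2 * prefix_gain m + K * e - 3.59587212 * e^2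
          - 0.06612 * m * e * (m^2 - e)
          - 0.031779 * e * (140 * m^4 * (m^2 - e) + 56 * m^2 * (m^4 - e^2) + 2 * (m^6 - e^3))"
      unfolding xz K_def prefix_gain_def e_def by algebra
    have "K \<le> 0"
    proof -
      have "m^3 \<le> 0.33^3" "m^6 \<le> 0.33^6" using m True by (auto intro: power_mono)
      then have "m^3 \<le> 0.036" "m^6 \<le> 0.0013" by (auto simp: power_divide)
      moreover define L where "L = (m - 0.33) * (59.1385224 - 69.57523272 * (m + 0.33))"
      moreover have "L \<le> 0"
        unfolding L_def using True by (intro mult_nonpos_nonneg) auto
      moreover have "K = L - 0.061030451208
          + 0.19836 * m^3 + 8.071866 * m^6"
        unfolding K_def L_def by algebra
      ultimately show ?thesis by simp
    qed
    then have "K * e \<le> 0" using e by (simp add: mult_nonpos_nonneg)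
    moreover have "0 \<le> 0.06612 * m * e * (m^2 - e)" using m e by simp
    moreover have "e^2 \<le> m^4" "e^3 \<le> m^6"
      using power_mono[OF e(2,1), of 2] power_mono[OF e(2,1), of 3] by (simp_all flip: power_mult)
    then have "0 \<le> 0.031779 * e * (140 * m^4 * (m^2 - e) + 56 * m^2 * (m^4 - e^2) + 2 * (m^6 - e^3))"
      using m e by (intro mult_nonneg_nonneg add_nonneg_nonneg) auto
    moreover have "0 \<le> 3.59587212 * e^2" by simp
    ultimately show ?thesis using symmetric_bridge[OF m] unfolding expand by linarith
  next
    case False
    define K where "K = 11.1546 * m - 21.57523272 * m^2 - 12 * (1 - 2 * m)\<^sup>2"
    define M where "M = 12 * (1 - 2 * m)\<^sup>2 * m^2 + 2 * (1.8591 * m^3 - 1.79793606 * m^4)"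
    have "12 * (1 - x - z)\<^sup>2 * x * z + (1.8591 * x^3 - 1.79793606 * x^4) + (1.8591 * z^3 - 1.79793606 * z^4)
        = M + K * e - 3.59587212 * e^2"
      unfolding xz K_def M_def e_def by algebra
    moreover have "M + K * e \<le> 0.244"
    proof (cases "K \<le> 0")
      case True
      then have "K * e \<le> 0" using e by (simp add: mult_nonpos_nonneg)
      then show ?thesis using quartic_bridge(1)[of m] m False unfolding M_def by linarith
    next
      case K: False
      then have "K * e \<le> K * (1/2 - m)\<^sup>2" using e by (intro mult_left_mono) auto
      then show ?thesis using quartic_bridge(2)[of m] m False unfolding M_def K_def by linarith
    qed
    moreover have "0 \<le> 3.59587212 * e^2" "(0.244 :: real) \<le> 0.244054548" by simp_all
    ultimately show ?thesis
      using prefix_gain_le_quartic[OF x] prefix_gain_le_quartic[OF z] by linarith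
  qed
qed

text \<open>
  Reversing a path, \<open>x \<mapsto> 1 - x\<close>, preserves the weights of its steps. To the right of 1/2 the
  potential is therefore the bound on the whole path minus the gain of the part still to come.
\<close>

definition potential :: "real \<Rightarrow> real" where
  "potential x = (if x \<le> 1/2 then prefix_gain x else 0.244054548 - prefix_gain (1 - x))"

lemma potential_step:
  assumes "0 \<le> x" "x \<le> y" "y \<le> 1"
  shows "12 * (y - x)\<^sup>2 * x * (1 - y) \<le> potential y - potential x"
proof -
  consider "y \<le> 1/2" | "x \<le> 1/2" "1/2 < y" | "1/2 < x" by linarith
  then show ?thesis
  proof cases
    case 1
    then show ?thesis using prefix_gain_step[of x y] assms by (simp add: potential_def)
  next
    case 2
    then have "potential y - potential x = 0.244054548 - prefix_gain (1 - y) - prefix_gain x"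
      by (simp add: potential_def)
    moreover have "12 * (y - x)\<^sup>2 * x * (1 - y) + prefix_gain x + prefix_gain (1 - y) \<le> 0.244054548"
      using bridge[of x "1 - y"] assms 2 by (simp add: algebra_simps)
    ultimately show ?thesis by linarith
  next
    case 3
    then show ?thesis using prefix_gain_step[of "1 - y" "1 - x"] assms
      by (simp add: potential_def mult_ac)
  qed
qed

lemma potential_0: "potential 0 = 0" and potential_1: "potential 1 = 0.244054548"
  by (simp_all add: potential_def prefix_gain_def)

section \<open>Occurrences of 1324 and the upper bound\<close>

lemma nths_eq_map_sorted_list_of_set:
  assumes "K \<subseteq> {..<length xs}"
  shows "nths xs K = map ((!) xs) (sorted_list_of_set K)"
proof -
  have "filter (\<lambda>i. i \<in> K) [0..<length xs] = sorted_list_of_set K"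
    using assms
    by (intro sorted_distinct_set_unique) (auto simp: finite_subset intro: sorted_wrt_filter)
  moreover have "zip xs [0..<length xs] = map (\<lambda>i. (xs ! i, i)) [0..<length xs]"
    by (rule nth_equalityI) auto
  ultimately show ?thesis
    by (simp add: nths_def filter_map o_def)
qed

definition occurrence_positions :: "nat list \<Rightarrow> (nat \<times> nat \<times> nat \<times> nat) set" where
  "occurrence_positions P = {(a, b, c, d). a < b \<and> b < c \<and> c < d \<and> d < length P
     \<and> P ! a < P ! c \<and> P ! c < P ! b \<and> P ! b < P ! d}"

lemma sorted_list_of_set_4:
  "a < b \<Longrightarrow> b < c \<Longrightarrow> c < d \<Longrightarrow> sorted_list_of_set {a, b, c, d :: nat} = [a, b, c, d]"
  using sorted_list_of_set.idem_if_sorted_distinct[of "[a, b, c, d]"] by simp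

lemma order_isomorphic_1324:
  "order_isomorphic [1, 3, 2, 4] [p, q, r, s] \<longleftrightarrow> p < r \<and> r < q \<and> q < s"
  by (auto simp: order_isomorphic_def All_less_Suc numeral_eq_Suc)

lemma card_occurrences_1324:
  "card (occurrences [1, 3, 2, 4] P) = card (occurrence_positions P)"
proof -
  let ?f = "\<lambda>(a, b, c, d). {a, b, c, d :: nat}"
  have "bij_betw ?f (occurrence_positions P) (occurrences [1, 3, 2, 4] P)"
    unfolding bij_betw_def
  proof (intro conjI equalityI subsetI)
    show "inj_on ?f (occurrence_positions P)"
    proof (rule inj_onI)
      fix p q
      assume pq: "p \<in> occurrence_positions P" "q \<in> occurrence_positions P" "?f p = ?f q"
      obtain a b c d where p: "p = (a, b, c, d)" by (cases p)
      obtain a' b' c' d' where q: "q = (a', b', c', d')" by (cases q)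
      have "sorted_list_of_set (?f p) = [a, b, c, d]" "sorted_list_of_set (?f q) = [a', b', c', d']"
        using pq(1,2) unfolding p q prod.case
        by (auto simp only: occurrence_positions_def mem_Collect_eq prod.case intro!: sorted_list_of_set_4)
      with pq(3) have "[a, b, c, d] = [a', b', c', d']" by metis
      then show "p = q" by (simp add: p q)
    qed
  next
    fix K assume "K \<in> ?f ` occurrence_positions P"
    then obtain a b c d where *: "(a, b, c, d) \<in> occurrence_positions P" and K: "K = {a, b, c, d}"
      by auto
    then have "K \<subseteq> {..<length P}" "card K = 4" by (auto simp: occurrence_positions_def)
    then show "K \<in> occurrences [1, 3, 2, 4] P"
      using * sorted_list_of_set_4[of a b c d] order_isomorphic_1324 nths_eq_map_sorted_list_of_set[of K P]
      by (simp add: occurrences_def occurrence_positions_def K)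
  next
    fix K assume K: "K \<in> occurrences [1, 3, 2, 4] P"
    then have fin: "finite K" "K \<subseteq> {..<length P}" by (auto simp: occurrences_def intro: finite_subset)
    have "length (sorted_list_of_set K) = 4" using K by (simp add: occurrences_def)
    moreover have "\<exists>a b c d. xs = [a, b, c, d]" if "length xs = 4" for xs :: "nat list"
      using that by (auto simp: length_Suc_conv numeral_eq_Suc)
    ultimately obtain a b c d where abcd: "sorted_list_of_set K = [a, b, c, d]"
      by blast
    have K_eq: "K = {a, b, c, d}" using abcd fin set_sorted_list_of_set[of K] by simp
    have "sorted_wrt (<) [a, b, c, d]" using abcd strict_sorted_list_of_set[of K] by simp
    then have "(a, b, c, d) \<in> occurrence_positions P"
      using K abcd fin(2) order_isomorphic_1324 nths_eq_map_sorted_list_of_set[OF fin(2)]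
      by (simp add: occurrences_def occurrence_positions_def K_eq)
    then show "K \<in> ?f ` occurrence_positions P" using K_eq by force
  qed
  then show ?thesis by (simp add: bij_betw_same_card)
qed

lemma pattern_density_1324:
  "pattern_density [1, 3, 2, 4] P = real (card (occurrence_positions P)) / real (length P choose 4)"
  unfolding pattern_density_def card_occurrences_1324 by (simp add: numeral_eq_Suc)

lemma finite_occurrence_positions: "finite (occurrence_positions P)"
  by (rule finite_subset[of _ "{..<length P} \<times> {..<length P} \<times> {..<length P} \<times> {..<length P}"])
    (auto simp: occurrence_positions_def)

lemma real_choose_4: "real (n choose 4) = real n * (real n - 1) * (real n - 2) * (real n - 3) / 24"
  by (simp add: binomial_gbinomial gbinomial_prod_rev numeral_eq_Suc)

lemma choose_4_bounds:
  assumes "4 \<le> n"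
  shows "24 * real (n choose 4) \<le> real n ^ 4" "(real n - 3) ^ 4 \<le> 24 * real (n choose 4)"
proof -
  have "real n * (real n - 1) * (real n - 2) * (real n - 3) \<le> real n * real n * real n * real n"
    using assms by (intro mult_mono) auto
  moreover have "(real n - 3) * (real n - 3) * (real n - 3) * (real n - 3)
      \<le> real n * (real n - 1) * (real n - 2) * (real n - 3)"
    using assms by (intro mult_mono) auto
  ultimately show "24 * real (n choose 4) \<le> real n ^ 4" "(real n - 3) ^ 4 \<le> 24 * real (n choose 4)"
    unfolding real_choose_4 by (simp_all add: power4_eq_xxxx)
qed

lemma packing_density_LIMSEQ: "max_density S \<longlonglongrightarrow> packing_density S"
  unfolding packing_density_def using convergent_max_density by (simp add: convergent_LIMSEQ_iff)

text \<open>
  All points of the permutation get the weight \<open>1 / n\<close>. An occurrence of 1324 yields two diamonds, as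
  the order of the middle pair does not matter in a diamond.
\<close>

lemma card_occurrence_positions_le:
  assumes n: "length P = n" "0 < n"
  shows "24 * real (card (occurrence_positions P)) \<le> 0.244054548 * real n ^ 4"
proof -
  interpret finite_strict_order "{..<n}" "\<lambda>i j. i < j \<and> P ! i < P ! j"
    by unfold_locales auto
  define swap where "swap = (\<lambda>(a :: nat, b :: nat, c :: nat, d :: nat). (a, c, b, d))"
  let ?O = "occurrence_positions P"
  have "card (swap ` ?O) = card ?O"
    by (rule card_image) (auto simp: swap_def inj_on_def)
  moreover have "?O \<inter> swap ` ?O = {}"
    by (auto simp: swap_def occurrence_positions_def)
  ultimately have "2 * card ?O = card (?O \<union> swap ` ?O)"
    using finite_occurrence_positions[of P] by (simp add: card_Un_disjoint)
  also have "\<dots> \<le> card diamonds"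
    by (rule card_mono[OF finite_diamonds])
      (auto simp: swap_def occurrence_positions_def diamonds_def n)
  finally have "2 * card ?O \<le> card diamonds" .
  then have "2 * real (card ?O) \<le> real (card diamonds)" by linarith
  moreover have "12 * diamond_weight (\<lambda>_. 1 / real n) \<le> potential 1 - potential 0"
    using n by (intro diamond_weight_le_potential potential_step) auto
  then have "12 * real (card diamonds) \<le> 0.244054548 * real n ^ 4"
    using n by (simp add: diamond_weight_def potential_0 potential_1 case_prod_unfold power4_eq_xxxx field_simps)
  ultimately show ?thesis by linarith
qed

lemma packing_density_le: "packing_density [1, 3, 2, 4] \<le> 0.244054548"
proof -
  let ?c = "0.244054548 :: real"
  have bound: "max_density [1, 3, 2, 4] (k + 4) \<le> ?c * (1 + 3 * inverse (real (Suc k))) ^ 4" for k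
  proof -
    let ?n = "k + 4"
    have "pattern_density [1, 3, 2, 4] P \<le> ?c * (1 + 3 * inverse (real (Suc k))) ^ 4"
      if P: "P \<in> permutations_of_set {1..?n}" for P
    proof -
      have len: "length P = ?n" using length_permutation[OF P] .
      have "24 * real (card (occurrence_positions P)) \<le> ?c * real ?n ^ 4"
        using len by (intro card_occurrence_positions_le) auto
      also have "real ?n = (1 + 3 * inverse (real (Suc k))) * (real ?n - 3)"
        by (simp add: field_simps)
      also have "?c * ((1 + 3 * inverse (real (Suc k))) * (real ?n - 3)) ^ 4
          = ?c * (1 + 3 * inverse (real (Suc k))) ^ 4 * (real ?n - 3) ^ 4"
        by (simp only: power_mult_distrib mult.assoc)
      also have "\<dots> \<le> ?c * (1 + 3 * inverse (real (Suc k))) ^ 4 * (24 * real (?n choose 4))"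
        by (intro mult_left_mono choose_4_bounds(2)) auto
      finally have "real (card (occurrence_positions P))
          \<le> ?c * (1 + 3 * inverse (real (Suc k))) ^ 4 * real (?n choose 4)"
        by linarith
      moreover have "0 < real (?n choose 4)" by simp
      ultimately show ?thesis
        unfolding pattern_density_1324 len by (subst pos_divide_le_eq)
    qed
    then show ?thesis unfolding max_density_def by (subst Max_le_iff) auto
  qed
  have "(\<lambda>k. max_density [1, 3, 2, 4] (k + 4)) \<longlonglongrightarrow> packing_density [1, 3, 2, 4]"
    by (rule LIMSEQ_ignore_initial_segment[OF packing_density_LIMSEQ])
  moreover have "(\<lambda>k. ?c * (1 + 3 * inverse (real (Suc k))) ^ 4) \<longlonglongrightarrow> ?c * (1 + 3 * 0) ^ 4"
    by (intro tendsto_intros LIMSEQ_inverse_real_of_nat)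
  ultimately have "packing_density [1, 3, 2, 4] \<le> ?c * (1 + 3 * 0) ^ 4"
    using bound by (intro LIMSEQ_le) auto
  then show ?thesis by simp
qed

section \<open>Layered permutations and the lower bound\<close>

text \<open>
  The witness is the layered permutation that maps every block of positions from \<open>Y j\<close> up to
  \<open>Y (Suc j)\<close> to the block of values at the same place, in decreasing order. Two positions \<open>b < c\<close>
  of one block, one position before the block and one after it form an occurrence.
\<close>

lemma layered_permutation_occurrences:
  fixes Y :: "nat \<Rightarrow> nat"
  assumes Y: "strict_mono_on {..r} Y" "Y 0 = 0"
  obtains P where "P \<in> permutations_of_set {1..Y r}"
    "(\<Sum>j<r. \<Sum>c=Y j..<Y (Suc j). (c - Y j) * (Y j * (Y r - Y (Suc j)))) \<le> card (occurrence_positions P)"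
proof -
  let ?n = "Y r"
  have Y_less: "Y i < Y j" if "i < j" "j \<le> r" for i j
    using Y(1) that by (auto simp: strict_mono_on_def)
  have Y_le: "Y i \<le> Y j" if "i \<le> j" "j \<le> r" for i j
    using Y_less[of i j] that by (cases "i = j") auto
  define block where "block k = (LEAST j. k < Y (Suc j))" for k
  have block: "block k < r" "Y (block k) \<le> k" "k < Y (Suc (block k))" if k: "k < ?n" for k
  proof -
    have r: "0 < r" using k Y(2) by (cases r) auto
    then have "k < Y (Suc (r - 1))" using k by simp
    then show "k < Y (Suc (block k))" and "block k < r"
      unfolding block_def using r LeastI[of "\<lambda>j. k < Y (Suc j)" "r - 1"] Least_le[of "\<lambda>j. k < Y (Suc j)" "r - 1"] by auto
    show "Y (block k) \<le> k"
    proof (cases "block k")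
      case 0
      then show ?thesis using Y(2) by simp
    next
      case (Suc j)
      then show ?thesis
        using not_less_Least[of j "\<lambda>j. k < Y (Suc j)"] by (simp add: block_def not_less)
    qed
  qed
  have block_unique: "i = j" if "Y i \<le> k" "k < Y (Suc i)" "Y j \<le> k" "k < Y (Suc j)" "i < r" "j < r" for i j k
  proof (rule ccontr)
    assume "i \<noteq> j"
    then consider "Suc i \<le> j" | "Suc j \<le> i" by linarith
    then show False using that Y_le[of "Suc i" j] Y_le[of "Suc j" i] by cases auto
  qed
  \<comment> \<open>The values start at 1 and the positions at 0, so reflecting a position in its block yields
  values from \<open>Y (block k) + 1\<close> to \<open>Y (Suc (block k))\<close>.\<close>
  define f where "f k = Y (block k) + Y (Suc (block k)) - k" for k
  define P where "P = map f [0..<?n]"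
  have f_range: "Y (block k) < f k" "f k \<le> Y (Suc (block k))" if "k < ?n" for k
    using block[OF that] by (auto simp: f_def)
  have inj: "inj_on f {0..<?n}"
  proof (rule inj_onI)
    fix k l assume kl: "k \<in> {0..<?n}" "l \<in> {0..<?n}" "f k = f l"
    have "f i < f j" if "block i < block j" "i < ?n" "j < ?n" for i j
    proof -
      have "f i \<le> Y (Suc (block i))" using f_range that by blast
      also have "\<dots> \<le> Y (block j)" using that block(1)[of j] by (intro Y_le) auto
      also have "\<dots> < f j" using f_range that by blast
      finally show ?thesis .
    qed
    from this[of k l] this[of l k] have "block k = block l" using kl by fastforce
    then show "k = l" using kl block[of k] block[of l] by (auto simp: f_def)
  qed
  have "f ` {0..<?n} \<subseteq> {1..?n}"
  proof
    fix i assume "i \<in> f ` {0..<?n}"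
    then obtain k where "k < ?n" "i = f k" by auto
    then show "i \<in> {1..?n}" using f_range[of k] block[of k] Y_le[of "Suc (block k)" r] by auto
  qed
  then have "f ` {0..<?n} = {1..?n}"
    using inj by (intro card_subset_eq) (auto simp: card_image)
  then have "P \<in> permutations_of_set {1..?n}"
    using inj by (simp add: P_def permutations_of_set_def distinct_map)
  moreover have "(\<Sum>j<r. \<Sum>c=Y j..<Y (Suc j). (c - Y j) * (Y j * (?n - Y (Suc j)))) \<le> card (occurrence_positions P)"
  proof -
    define T where "T = (SIGMA j:{..<r}. SIGMA c:{Y j..<Y (Suc j)}. {Y j..<c} \<times> {..<Y j} \<times> {Y (Suc j)..<?n})"
    define g where "g = (\<lambda>(j :: nat, c :: nat, b :: nat, a :: nat, d :: nat). (a, b, c, d))"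
    have "card T = (\<Sum>j<r. \<Sum>c=Y j..<Y (Suc j). (c - Y j) * (Y j * (?n - Y (Suc j))))"
      unfolding T_def by (simp add: card_SigmaI)
    moreover have "inj_on g T"
    proof (rule inj_onI)
      fix p q assume *: "p \<in> T" "q \<in> T" "g p = g q"
      obtain j c b a d j' where pq: "p = (j, c, b, a, d)" "q = (j', c, b, a, d)"
        using *(3) by (cases p; cases q) (simp add: g_def)
      then show "p = q"
        using block_unique[of j c j'] * by (simp add: T_def)
    qed
    moreover have "g ` T \<subseteq> occurrence_positions P"
    proof (rule image_subsetI)
      fix p assume "p \<in> T"
      moreover obtain j c b a d where p: "p = (j, c, b, a, d)" by (cases p)
      ultimately have *: "j < r" "Y j \<le> b" "b < c" "c < Y (Suc j)" "a < Y j" "Y (Suc j) \<le> d" "d < ?n"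
        by (auto simp: T_def)
      have n: "Y (Suc j) \<le> ?n" using Y_le[of "Suc j" r] * by simp
      have bc: "block b = j" "block c = j"
        using block_unique[of "block b" b j] block_unique[of "block c" c j] block[of b] block[of c] * n by auto
      have "block a < j"
      proof (rule ccontr)
        assume "\<not> block a < j"
        then have "Y j \<le> Y (block a)" using Y_le[of j "block a"] block[of a] * n by auto
        then show False using block[of a] * n by auto
      qed
      then have "f a \<le> Y j"
        using f_range[of a] Y_le[of "Suc (block a)" j] * n by auto
      moreover have "j < block d"
      proof (rule ccontr)
        assume "\<not> j < block d"
        then have "Y (Suc (block d)) \<le> Y (Suc j)" using Y_le[of "Suc (block d)" "Suc j"] * by auto
        then show False using block[of d] * by auto
      qed
      then have "Y (Suc j) < f d"
        using f_range[of d] Y_le[of "Suc j" "block d"] block[of d] * by auto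
      moreover have "Y j < f c" "f c < f b" "f b \<le> Y (Suc j)"
        using * bc f_range[of b] f_range[of c] n by (auto simp: f_def)
      ultimately show "g p \<in> occurrence_positions P"
        using * n by (auto simp: p g_def occurrence_positions_def P_def)
    qed
    ultimately show ?thesis
      using card_inj_on_le[OF _ _ finite_occurrence_positions, of g T P] by simp
  qed
  ultimately show ?thesis by (rule that)
qed

text \<open>
  The sum is the weight of the path with break points \<open>X j / X r\<close>. It is attained in the limit by
  the layered permutations whose layers are \<open>m\<close> times as long as the steps of \<open>X\<close>: replacing pairs
  by squares of the layer sizes costs a fraction of order \<open>1 / m\<close>.
\<close>

lemma packing_density_ge_layered:
  fixes X :: "nat \<Rightarrow> nat"
  assumes X: "strict_mono_on {..r} X" "X 0 = 0" and r: "0 < r"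
  shows "12 * (\<Sum>j<r. real (X j) * (real (X (Suc j)) - real (X j))\<^sup>2 * (real (X r) - real (X (Suc j)))) / real (X r) ^ 4
    \<le> packing_density [1, 3, 2, 4]"
proof -
  let ?N = "X r"
  let ?L = "\<lambda>j. real (X (Suc j)) - real (X j)"
  define A where "A = (\<Sum>j<r. real (X j) * (?L j)\<^sup>2 * (real ?N - real (X (Suc j))))"
  define B where "B = (\<Sum>j<r. real (X j) * ?L j * (real ?N - real (X (Suc j))))"
  have N: "0 < ?N" using strict_mono_onD[OF X(1), of 0 r] X(2) r by simp
  have le: "X j \<le> X (Suc j)" "X (Suc j) \<le> ?N" if "j < r" for j
    using strict_mono_on_leD[OF X(1), of j "Suc j"] strict_mono_on_leD[OF X(1), of "Suc j" r] that by auto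
  have bound: "12 * (A - B * inverse (real m)) / real ?N ^ 4 \<le> max_density [1, 3, 2, 4] (m * ?N)"
    if m: "4 \<le> m" for m
  proof -
    let ?n = "m * ?N"
    have n: "4 \<le> ?n" using m N by (metis mult_le_mono nat_mult_1_right Suc_leI One_nat_def)
    have "strict_mono_on {..r} (\<lambda>j. m * X j)" "m * X 0 = 0"
      using X m by (auto simp: strict_mono_on_def)
    then obtain P where P: "P \<in> permutations_of_set {1..?n}"
      and count: "(\<Sum>j<r. \<Sum>c=m * X j..<m * X (Suc j). (c - m * X j) * (m * X j * (?n - m * X (Suc j))))
        \<le> card (occurrence_positions P)"
      by (rule layered_permutation_occurrences)
    have len: "length P = ?n" using length_permutation[OF P] .
    have term_eq: "real (\<Sum>c=m * X j..<m * X (Suc j). (c - m * X j) * (m * X j * (?n - m * X (Suc j))))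
      = real m ^ 4 / 2 * (real (X j) * (?L j)\<^sup>2 * (real ?N - real (X (Suc j)))
          - real (X j) * ?L j * (real ?N - real (X (Suc j))) * inverse (real m))" if j: "j < r" for j
    proof -
      have pairs: "2 * real (\<Sum>c=l..<l + k. c - l) = real k * (real k - 1)" for l k :: nat
        by (induction k) (simp_all add: algebra_simps)
      have *: "m * X (Suc j) = m * X j + m * (X (Suc j) - X j)"
        using le[OF j] by (simp flip: distrib_left)
      have twice: "2 * real (\<Sum>c=m * X j..<m * X (Suc j). c - m * X j) = (real m * ?L j) * (real m * ?L j - 1)"
        using pairs[of "m * X j" "m * (X (Suc j) - X j)"] le[OF j] unfolding *[symmetric] by (simp add: of_nat_diff)
      have split: "real (\<Sum>c=m * X j..<m * X (Suc j). (c - m * X j) * (m * X j * (?n - m * X (Suc j))))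
          = real (\<Sum>c=m * X j..<m * X (Suc j). c - m * X j) * real (m * X j * (?n - m * X (Suc j)))"
        by (simp only: sum_distrib_right[symmetric] of_nat_mult)
      have val: "real (m * X j * (?n - m * X (Suc j)))
          = real m * real (X j) * (real m * real ?N - real m * real (X (Suc j)))"
        using le[OF j] by (simp add: of_nat_diff)
      have alg: "s * (M * x * (M * N - M * y))
          = M ^ 4 / 2 * (x * L\<^sup>2 * (N - y) - x * L * (N - y) * inverse M)"
        if "2 * s = (M * L) * (M * L - 1)" "M * inverse M = 1" for s M L x y N :: real
        using that by algebra
      show ?thesis unfolding split val by (rule alg[OF twice]) (use m in simp)
    qed
    have "M * (sum f J - sum g J * i) = (\<Sum>j\<in>J. M * (f j - g j * i))"
      for M i :: real and f g :: "nat \<Rightarrow> real" and J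
      by (simp add: sum_distrib_left sum_distrib_right flip: sum_subtractf)
    then have "real m ^ 4 / 2 * (A - B * inverse (real m))
        = real (\<Sum>j<r. \<Sum>c=m * X j..<m * X (Suc j). (c - m * X j) * (m * X j * (?n - m * X (Suc j))))"
      unfolding of_nat_sum[of _ "{..<r}"] A_def B_def by (simp add: term_eq del: of_nat_sum)
    also have "\<dots> \<le> real (card (occurrence_positions P))"
      using count by (rule of_nat_mono)
    finally have 1: "real m ^ 4 / 2 * (A - B * inverse (real m)) \<le> real (card (occurrence_positions P))" .
    have choose: "0 < real (?n choose 4)" using n by simp
    have 2: "24 * real (?n choose 4) \<le> real m ^ 4 * real ?N ^ 4"
      using choose_4_bounds(1)[OF n] by (simp add: power_mult_distrib)
    define Z where "Z = A - B * inverse (real m)"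
    have "12 * Z / real ?N ^ 4 \<le> pattern_density [1, 3, 2, 4] P"
    proof (cases "0 \<le> Z")
      case True
      have "12 * Z * real (?n choose 4) \<le> real m ^ 4 / 2 * Z * real ?N ^ 4"
        using mult_left_mono[OF 2 True] by (simp add: mult_ac)
      also have "\<dots> \<le> real (card (occurrence_positions P)) * real ?N ^ 4"
        using 1 unfolding Z_def by (rule mult_right_mono) simp
      finally show ?thesis
        unfolding pattern_density_1324 len using choose N by (simp add: field_simps)
    next
      case False
      then have "12 * Z / real ?N ^ 4 \<le> 0"
        using N by (intro divide_nonpos_pos) auto
      also have "0 \<le> pattern_density [1, 3, 2, 4] P" by (simp add: pattern_density_def)
      finally show ?thesis .
    qed
    also have "\<dots> \<le> max_density [1, 3, 2, 4] ?n" by (rule pattern_density_le_max[OF P])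
    finally show ?thesis unfolding Z_def .
  qed
  have "(\<lambda>k. 12 * (A - B * inverse (real (Suc k))) / real ?N ^ 4) \<longlonglongrightarrow> 12 * (A - B * 0) / real ?N ^ 4"
    by (intro tendsto_intros LIMSEQ_inverse_real_of_nat) (use N in auto)
  moreover have "(\<lambda>k. max_density [1, 3, 2, 4] (Suc k * ?N)) \<longlonglongrightarrow> packing_density [1, 3, 2, 4]"
    using N by (intro LIMSEQ_subseq_LIMSEQ[OF packing_density_LIMSEQ, unfolded o_def] strict_monoI) auto
  moreover have "\<exists>K. \<forall>k\<ge>K. 12 * (A - B * inverse (real (Suc k))) / real ?N ^ 4 \<le> max_density [1, 3, 2, 4] (Suc k * ?N)"
    by (intro exI[of _ 3] allI impI bound) simp
  ultimately have "12 * (A - B * 0) / real ?N ^ 4 \<le> packing_density [1, 3, 2, 4]"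
    by (rule LIMSEQ_le)
  then show ?thesis by (simp add: A_def)
qed

text \<open>
  The best path with six break points on either side of 1/2, rounded to multiples of 1/898. Its weight is
  0.24405438...
\<close>

lemma packing_density_gt: "0.244054321 < packing_density [1, 3, 2, 4]"
proof -
  define cuts where "cuts = [0, 2, 5, 14, 38, 103, 274, 624, 795, 860, 884, 893, 896, 898 :: nat]"
  have "strict_mono_on {..13} (nth cuts)"
    unfolding strict_mono_on_def
    using sorted_wrt_nth_less[of "(<)" cuts] by (auto simp: cuts_def)
  from packing_density_ge_layered[OF this] show ?thesis
    by (simp add: cuts_def lessThan_Suc numeral_eq_Suc)
qed

theorem theorem2:
  shows "0.244054321 < packing_density [1, 3, 2, 4] \<and>
         packing_density [1, 3, 2, 4] < 0.244054549"
  using packing_density_gt packing_density_le by simp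

end
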